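(* Let $A,B\in\mathbb{R}^{n\times n}$. The matrix $A+BD$ is nonsingular for every $D\in[-I_n,I_n]$ if and only if the interval matrix $$\begin{pmatrix}A&B\\ [-I_n,I_n]&I_n\end{pmatrix}$$ is regular.
   Context: For real matrices $\underline{M}\leq\overline{M}$ of the same size (inequalities entrywise), the interval matrix $[\underline{M},\overline{M}]$ is the set of all real matrices $M$ with $\underline{M}\leq M\leq\overline{M}$ entrywise; a square interval matrix is called regular if every matrix in it is nonsingular. $I_n$ is the $n\times n$ identity matrix, and $[-I_n,I_n]$ is the set of diagonal $n\times n$ matrices with diagonal entries in $[-1,1]$. The displayed block interval matrix is the set of all $2n\times 2n$ matrices $\begin{pmatrix}A&B\\ D&I_n\end{pmatrix}$ with $D\in[-I_n,I_n]$. *)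

theory Defs
  imports Jordan_Normal_Form.Matrix
begin

text \<open>The order on type \<open>mat\<close> is entrywise (and requires equal dimensions), so the interval
  matrix with bounds \<open>L\<close> and \<open>U\<close> is the order interval \<open>{L..U}\<close>.\<close>

definition regular_interval_mat :: "real mat set \<Rightarrow> bool" where
  "regular_interval_mat \<M> \<longleftrightarrow> (\<forall>M\<in>\<M>. invertible_mat M)"

definition block_interval_mat :: "nat \<Rightarrow> real mat \<Rightarrow> real mat \<Rightarrow> real mat set" where
  "block_interval_mat n A B = {four_block_mat A B D (1\<^sub>m n) | D. D \<in> {- 1\<^sub>m n..1\<^sub>m n}}"

text \<open>Sanity checks: intervals are entrywise, the interval \<open>{- 1\<^sub>m n..1\<^sub>m n}\<close> consists of the
  diagonal matrices with diagonal entries in \<open>[-1, 1]\<close>, and the block set above is itself an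
  interval matrix.\<close>

lemma mem_interval_mat_iff:
  fixes L U M :: "real mat"
  assumes L: "L \<in> carrier_mat r c" and U: "U \<in> carrier_mat r c"
  shows "M \<in> {L..U} \<longleftrightarrow> M \<in> carrier_mat r c \<and>
    (\<forall>i<r. \<forall>j<c. L $$ (i, j) \<le> M $$ (i, j) \<and> M $$ (i, j) \<le> U $$ (i, j))"
proof -
  have dims: "dim_row L = r" "dim_col L = c" "dim_row U = r" "dim_col U = c"
    using L U by simp_all
  have "L \<le> M \<and> M \<le> U \<longleftrightarrow> dim_row M = r \<and> dim_col M = c \<and> L \<le> M \<and> M \<le> U"
    unfolding less_eq_mat_def dims by blast
  also have "\<dots> \<longleftrightarrow> dim_row M = r \<and> dim_col M = c \<and>
    (\<forall>i<r. \<forall>j<c. L $$ (i, j) \<le> M $$ (i, j)) \<and> (\<forall>i<r. \<forall>j<c. M $$ (i, j) \<le> U $$ (i, j))"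
    by (intro conj_cong refl) (simp_all add: less_eq_mat_def dims)
  finally show ?thesis
    unfolding atLeastAtMost_iff carrier_mat_def mem_Collect_eq by blast
qed

lemma mem_unit_interval_mat_iff:
  fixes D :: "real mat"
  shows "D \<in> {- 1\<^sub>m n..1\<^sub>m n} \<longleftrightarrow>
    D \<in> carrier_mat n n \<and> diagonal_mat D \<and> (\<forall>i<n. D $$ (i, i) \<in> {-1..1})"
proof -
  have "D \<in> {- 1\<^sub>m n..1\<^sub>m n} \<longleftrightarrow> D \<in> carrier_mat n n \<and>
    (\<forall>i<n. \<forall>j<n. (- 1\<^sub>m n) $$ (i, j) \<le> D $$ (i, j) \<and> D $$ (i, j) \<le> 1\<^sub>m n $$ (i, j))"
    by (rule mem_interval_mat_iff) simp_all
  also have "\<dots> \<longleftrightarrow> D \<in> carrier_mat n n \<and>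
    (\<forall>i<n. \<forall>j<n. (i \<noteq> j \<longrightarrow> D $$ (i, j) = 0) \<and> (i = j \<longrightarrow> D $$ (i, i) \<in> {-1..1}))"
    (is "_ \<and> ?P \<longleftrightarrow> _ \<and> ?Q")
  proof -
    have "(- 1\<^sub>m n) $$ (i, j) \<le> D $$ (i, j) \<and> D $$ (i, j) \<le> 1\<^sub>m n $$ (i, j) \<longleftrightarrow>
      (i \<noteq> j \<longrightarrow> D $$ (i, j) = 0) \<and> (i = j \<longrightarrow> D $$ (i, i) \<in> {-1..1})" if "i < n" "j < n" for i j
      using that by (cases "i = j") auto
    then have "?P \<longleftrightarrow> ?Q" by blast
    then show ?thesis by blast
  qed
  also have "\<dots> \<longleftrightarrow> D \<in> carrier_mat n n \<and> diagonal_mat D \<and> (\<forall>i<n. D $$ (i, i) \<in> {-1..1})"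
  proof (rule conj_cong[OF refl])
    assume "D \<in> carrier_mat n n"
    then have dims: "dim_row D = n" "dim_col D = n" by simp_all
    show "?Q \<longleftrightarrow> diagonal_mat D \<and> (\<forall>i<n. D $$ (i, i) \<in> {-1..1})"
      unfolding diagonal_mat_def dims by (intro iffI conjI allI impI) simp_all
  qed
  finally show ?thesis .
qed

lemma block_interval_mat_eq:
  assumes A: "A \<in> carrier_mat n n" and B: "B \<in> carrier_mat n n"
  shows "block_interval_mat n A B =
    {four_block_mat A B (- 1\<^sub>m n) (1\<^sub>m n)..four_block_mat A B (1\<^sub>m n) (1\<^sub>m n)}"
    (is "_ = {?L..?U}")
proof -
  have dims: "dim_row A = n" "dim_col A = n" "dim_row B = n" "dim_col B = n"
    using A B by auto
  have LU: "M \<in> {?L..?U} \<longleftrightarrow> M \<in> carrier_mat (n + n) (n + n) \<and>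
    (\<forall>i<n + n. \<forall>j<n + n. ?L $$ (i, j) \<le> M $$ (i, j) \<and> M $$ (i, j) \<le> ?U $$ (i, j))" for M
    by (rule mem_interval_mat_iff) (use A in simp_all)
  have I: "D \<in> {- 1\<^sub>m n..1\<^sub>m n} \<longleftrightarrow> D \<in> carrier_mat n n \<and>
    (\<forall>i<n. \<forall>j<n. (- 1\<^sub>m n) $$ (i, j) \<le> D $$ (i, j) \<and> D $$ (i, j) \<le> 1\<^sub>m n $$ (i, j))"
    for D :: "real mat"
    by (rule mem_interval_mat_iff) simp_all
  show ?thesis
  proof (intro equalityI subsetI)
    fix M assume "M \<in> block_interval_mat n A B"
    then obtain D where M: "M = four_block_mat A B D (1\<^sub>m n)" and D: "D \<in> {- 1\<^sub>m n..1\<^sub>m n}"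
      unfolding block_interval_mat_def by blast
    have dD: "dim_row D = n" "dim_col D = n"
      using D[unfolded I, THEN conjunct1] by simp_all
    have bnd: "(- 1\<^sub>m n) $$ (i, j) \<le> D $$ (i, j) \<and> D $$ (i, j) \<le> 1\<^sub>m n $$ (i, j)"
      if "i < n" "j < n" for i j
      using D that unfolding I by blast
    have "?L $$ (i, j) \<le> M $$ (i, j) \<and> M $$ (i, j) \<le> ?U $$ (i, j)"
      if "i < n + n" "j < n + n" for i j
    proof (cases "i < n \<or> n \<le> j")
      case True
      then show ?thesis using that by (auto simp: M dims dD)
    next
      case False
      then show ?thesis using that bnd[of "i - n" j] by (simp add: M dims dD)
    qed
    moreover have "M \<in> carrier_mat (n + n) (n + n)"
      unfolding M using A by simp
    ultimately show "M \<in> {?L..?U}"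
      unfolding LU by blast
  next
    fix M assume M: "M \<in> {?L..?U}"
    have dim: "dim_row M = n + n" "dim_col M = n + n"
      using M[unfolded LU, THEN conjunct1] by simp_all
    have bnd: "?L $$ (i, j) \<le> M $$ (i, j) \<and> M $$ (i, j) \<le> ?U $$ (i, j)"
      if "i < n + n" "j < n + n" for i j
      using M that unfolding LU by blast
    define D where "D = mat n n (\<lambda>(i, j). M $$ (i + n, j))"
    have "(- 1\<^sub>m n) $$ (i, j) \<le> D $$ (i, j) \<and> D $$ (i, j) \<le> 1\<^sub>m n $$ (i, j)"
      if "i < n" "j < n" for i j
      using bnd[of "i + n" j] that by (simp add: D_def dims)
    moreover have "D \<in> carrier_mat n n"
      by (simp add: D_def)
    ultimately have "D \<in> {- 1\<^sub>m n..1\<^sub>m n}"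
      unfolding I by blast
    moreover have "M = four_block_mat A B D (1\<^sub>m n)"
    proof (rule eq_matI)
      fix i j
      assume "i < dim_row (four_block_mat A B D (1\<^sub>m n))" "j < dim_col (four_block_mat A B D (1\<^sub>m n))"
      then have ij: "i < n + n" "j < n + n" using dims by simp_all
      show "M $$ (i, j) = four_block_mat A B D (1\<^sub>m n) $$ (i, j)"
      proof (cases "i < n \<or> n \<le> j")
        case True
        then have "?L $$ (i, j) = ?U $$ (i, j)"
          "four_block_mat A B D (1\<^sub>m n) $$ (i, j) = ?U $$ (i, j)"
          using ij by (auto simp: dims D_def)
        then show ?thesis using bnd[OF ij] by linarith
      next
        case False
        then show ?thesis using ij by (simp add: D_def dims)
      qed
    qed (simp_all add: dim dims)
    ultimately show "M \<in> block_interval_mat n A B"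
      unfolding block_interval_mat_def by blast
  qed
qed

end

theory Submission
  imports Defs Jordan_Normal_Form.Determinant
begin

text \<open>
  The identity block commutes with every \<open>D\<close>, so the block determinant formula gives
  \<open>det (four_block_mat A B D (1\<^sub>m n)) = det (A - B * D)\<close>. As singularity over a field is the
  vanishing of the determinant, the block matrix belonging to \<open>D\<close> is nonsingular iff
  \<open>A - B * D\<close> is. The sign disappears because \<open>D \<mapsto> - D\<close> maps the interval
  \<open>{- 1\<^sub>m n..1\<^sub>m n}\<close> onto itself.
\<close>

lemma invertible_mat_iff_det:
  fixes M :: "'a :: field mat"
  assumes M: "M \<in> carrier_mat n n"
  shows "invertible_mat M \<longleftrightarrow> det M \<noteq> 0"
proof
  assume "invertible_mat M"
  then obtain N where MN: "M * N = 1\<^sub>m n" and NM: "N * M = 1\<^sub>m (dim_row N)"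
    using M by (auto simp: invertible_mat_def inverts_mat_def)
  \<comment> \<open>The definition of invertibility leaves the size of the inverse open; the two products fix it.\<close>
  have "dim_col N = n" and "dim_row N = n"
    using M arg_cong[OF MN, of dim_col] arg_cong[OF NM, of dim_col] by simp_all
  then have N: "N \<in> carrier_mat n n" by auto
  have "det M * det N = 1"
    using det_mult[OF M N] MN by simp
  then show "det M \<noteq> 0" by auto
next
  assume "det M \<noteq> 0"
  then have "M \<in> Units (ring_mat TYPE('a) n ())"
    by (rule det_non_zero_imp_unit[OF M])
  then obtain N where "N \<in> carrier_mat n n" "N * M = 1\<^sub>m n" "M * N = 1\<^sub>m n"
    by (auto simp: Units_def ring_mat_simps)
  then show "invertible_mat M"
    using M by (auto simp: invertible_mat_def inverts_mat_def)
qed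

lemma invertible_four_block_mat_one_iff:
  fixes A B D :: "'a :: field mat"
  assumes A: "A \<in> carrier_mat n n" and B: "B \<in> carrier_mat n n" and D: "D \<in> carrier_mat n n"
  shows "invertible_mat (four_block_mat A B D (1\<^sub>m n)) \<longleftrightarrow> invertible_mat (A - B * D)"
proof -
  have "four_block_mat A B D (1\<^sub>m n) \<in> carrier_mat (n + n) (n + n)"
    using A by simp
  moreover have "A - B * D \<in> carrier_mat n n"
    using minus_carrier_mat[OF mult_carrier_mat[OF B D]] .
  moreover have "det (four_block_mat A B D (1\<^sub>m n)) = det (A - B * D)"
    using det_four_block_mat[OF A B D one_carrier_mat] A D by simp
  ultimately show ?thesis
    by (simp add: invertible_mat_iff_det)
qed

lemma uminus_mem_unit_interval_mat:
  fixes D :: "real mat"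
  assumes "D \<in> {- 1\<^sub>m n..1\<^sub>m n}"
  shows "- D \<in> {- 1\<^sub>m n..1\<^sub>m n}"
  using assms unfolding mem_unit_interval_mat_iff by (fastforce simp: diagonal_mat_def)

theorem theorem5:
  fixes A B :: "real mat" and n :: nat
  assumes "A \<in> carrier_mat n n" and "B \<in> carrier_mat n n"
  shows "(\<forall>D \<in> {- 1\<^sub>m n..1\<^sub>m n}. invertible_mat (A + B * D)) \<longleftrightarrow>
    regular_interval_mat (block_interval_mat n A B)"
proof -
  let ?I = "{- 1\<^sub>m n..1\<^sub>m n} :: real mat set"
  have carrier: "D \<in> carrier_mat n n" if "D \<in> ?I" for D
    using that by (simp only: mem_unit_interval_mat_iff)
  have plus: "A + B * D = A - B * (- D)" if "D \<in> ?I" for D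
    using assms carrier[OF that] by (intro eq_matI) simp_all
  have reflect: "?I = uminus ` ?I"
  proof (intro equalityI subsetI)
    fix D assume D: "D \<in> ?I"
    have "D = - (- D)" by (intro eq_matI) simp_all
    then show "D \<in> uminus ` ?I"
      using uminus_mem_unit_interval_mat[OF D] by blast
  qed (use uminus_mem_unit_interval_mat in blast)
  have "(\<forall>D\<in>?I. invertible_mat (A + B * D)) \<longleftrightarrow> (\<forall>D\<in>?I. invertible_mat (A - B * (- D)))"
    by (intro ball_cong refl) (simp only: plus)
  also have "\<dots> \<longleftrightarrow> (\<forall>D\<in>uminus ` ?I. invertible_mat (A - B * D))"
    by blast
  also have "\<dots> \<longleftrightarrow> (\<forall>D\<in>?I. invertible_mat (A - B * D))"
    by (simp only: reflect[symmetric])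
  also have "\<dots> \<longleftrightarrow> (\<forall>D\<in>?I. invertible_mat (four_block_mat A B D (1\<^sub>m n)))"
    using invertible_four_block_mat_one_iff[OF assms carrier] by blast
  also have "\<dots> \<longleftrightarrow> regular_interval_mat (block_interval_mat n A B)"
    unfolding regular_interval_mat_def block_interval_mat_def by blast
  finally show ?thesis .
qed

end
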